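(* Let $(S,\cdot)$ be a semigroup. Then for each $k\in\mathbb{N}$, the set $k\text{-}SCR(S)=\{p\in\beta S: \text{every } A\in p \text{ is a } k\text{-}SCR\text{-set}\}$ is a two sided ideal of $\beta S$.
   Context: $\beta S$ is the Stone–Čech compactification of the discrete semigroup $S$, viewed as the set of ultrafilters on $S$, with the operation extending that of $S$: for $p,q\in\beta S$, $p\cdot q=\{A\subseteq S:\{x\in S: x^{-1}A\in q\}\in p\}$, where $x^{-1}A=\{y\in S: xy\in A\}$. ${}^{\mathbb{N}}S$ denotes the set of functions $f:\mathbb{N}\to S$ and $\mathcal{P}_f(X)$ the set of finite nonempty subsets of $X$. For $k\in\mathbb{N}$, a set $A\subseteq S$ is a $k$-strong combinatorially rich set ($k\text{-}SCR$-set) if there exists $r\in\mathbb{N}$ such that for each $F\in\mathcal{P}_f({}^{\mathbb{N}}S)$ with $|F|\le k$, there exist $(a_1,a_2)\in S^2$ and $t\in\mathbb{N}$ with $t\le r$ such that $a_1 f(t) a_2\in A$ for each $f\in F$. *)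

theory Defs
  imports Main "HOL-Library.FuncSet"
begin

(* The semigroup S is a type of class semigroup_mult. A point of the Stone-Cech compactification
   of the discrete space S is an ultrafilter on S, taken as a set of subsets of S. *)

definition is_ultrafilter :: "'a set set \<Rightarrow> bool" where
  "is_ultrafilter p \<longleftrightarrow>
     UNIV \<in> p \<and> {} \<notin> p \<and>
     (\<forall>A B. A \<in> p \<longrightarrow> B \<in> p \<longrightarrow> A \<inter> B \<in> p) \<and>
     (\<forall>A B. A \<in> p \<longrightarrow> A \<subseteq> B \<longrightarrow> B \<in> p) \<and>
     (\<forall>A. A \<in> p \<or> - A \<in> p)"

definition beta :: "'a set set set" where
  "beta = {p. is_ultrafilter p}"

definition left_translate_inv :: "'a::semigroup_mult \<Rightarrow> 'a set \<Rightarrow> 'a set" where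
  "left_translate_inv x A = {y. x * y \<in> A}"

definition beta_mult :: "'a::semigroup_mult set set \<Rightarrow> 'a set set \<Rightarrow> 'a set set" where
  "beta_mult p q = {A. {x. left_translate_inv x A \<in> q} \<in> p}"

(* The positive integers are {1..} :: nat set, and a function from them to S is an extensional
   function on {1..}, so that card F counts distinct functions on the positive integers. *)

definition k_SCR_set :: "nat \<Rightarrow> 'a::semigroup_mult set \<Rightarrow> bool" where
  "k_SCR_set k A \<longleftrightarrow>
     (\<exists>r\<in>{1::nat..}. \<forall>F. F \<subseteq> ({1..} \<rightarrow>\<^sub>E (UNIV :: 'a set)) \<and> finite F \<and> F \<noteq> {} \<and> card F \<le> k \<longrightarrow>
        (\<exists>a1 a2. \<exists>t\<in>{1..}. t \<le> r \<and> (\<forall>f\<in>F. a1 * f t * a2 \<in> A)))"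

definition k_SCR :: "nat \<Rightarrow> 'a::semigroup_mult set set set" where
  "k_SCR k = {p \<in> beta. \<forall>A\<in>p. k_SCR_set k A}"

(* The empty set is admitted as an ideal. This matters: k_SCR k can be empty. In the additive
   semigroup of positive integers no ultrafilter lies in k_SCR k for k >= 2, since it contains the
   evens or the odds, and neither set contains both a1 + 1 + a2 and a1 + 2 + a2 (take for F the
   constant sequences 1 and 2). *)

definition two_sided_ideal :: "'b set \<Rightarrow> ('b \<Rightarrow> 'b \<Rightarrow> 'b) \<Rightarrow> 'b set \<Rightarrow> bool" where
  "two_sided_ideal T mul I \<longleftrightarrow>
     I \<subseteq> T \<and> (\<forall>x\<in>T. \<forall>y\<in>I. mul x y \<in> I \<and> mul y x \<in> I)"

end

theory Submission
  imports Defs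
begin

text \<open>
  If the inverse translate of A by s is rich with witnesses (a1, a2), then A is rich with witnesses (s a1, a2).
  For the product on the other side, if the set of x whose inverse translate of A lies in an ultrafilter p is rich with witnesses
  (a1, a2), then, F being finite, the inverse translates by the elements a1 f(t) a2 with f in F all
  contain a common element b, so that (a1, a2 b) are witnesses for A. In both cases the bound r
  on t is unchanged.
\<close>

lemma ultrafilter_mono: "is_ultrafilter p \<Longrightarrow> A \<in> p \<Longrightarrow> A \<subseteq> B \<Longrightarrow> B \<in> p"
  by (simp add: is_ultrafilter_def)

lemma ultrafilter_Int: "is_ultrafilter p \<Longrightarrow> A \<in> p \<Longrightarrow> B \<in> p \<Longrightarrow> A \<inter> B \<in> p"
  by (simp add: is_ultrafilter_def)

lemma ultrafilter_Compl_iff: "is_ultrafilter p \<Longrightarrow> - A \<in> p \<longleftrightarrow> A \<notin> p"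
  unfolding is_ultrafilter_def by (metis Compl_disjoint)

lemma ultrafilter_nonempty: "is_ultrafilter p \<Longrightarrow> A \<in> p \<Longrightarrow> \<exists>x. x \<in> A"
  unfolding is_ultrafilter_def by (cases "A = {}") auto

lemma ultrafilter_finite_INT:
  assumes "is_ultrafilter p" "finite I" "\<And>i. i \<in> I \<Longrightarrow> B i \<in> p"
  shows "(\<Inter>i\<in>I. B i) \<in> p"
  using assms(2,3)
proof (induction I)
  case empty
  then show ?case using assms(1) by (simp add: is_ultrafilter_def)
next
  case (insert i I)
  then show ?case using ultrafilter_Int[OF assms(1)] by simp
qed

text \<open>For fixed \<open>x\<close>, taking the inverse translate by \<open>x\<close> is taking a
  preimage, so it commutes with intersections and complements and preserves inclusions. Each
  ultrafilter law therefore holds for \<open>?T\<close> by applying it in \<open>q\<close> pointwise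
  in \<open>x\<close>, and then once more in \<open>p\<close>.\<close>

lemma beta_mult_is_ultrafilter:
  assumes p: "is_ultrafilter p" and q: "is_ultrafilter q"
  shows "is_ultrafilter (beta_mult p q)"
proof -
  let ?T = "\<lambda>A. {x. left_translate_inv x A \<in> q}"
  have mem: "A \<in> beta_mult p q \<longleftrightarrow> ?T A \<in> p" for A
    by (simp add: beta_mult_def)
  have "UNIV \<in> beta_mult p q" "{} \<notin> beta_mult p q"
    using p q by (simp_all add: mem left_translate_inv_def is_ultrafilter_def)
  moreover have "A \<inter> B \<in> beta_mult p q" if "A \<in> beta_mult p q" "B \<in> beta_mult p q" for A B
  proof -
    have "left_translate_inv x (A \<inter> B) = left_translate_inv x A \<inter> left_translate_inv x B" for x
      by (auto simp: left_translate_inv_def)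
    \<comment> \<open>This inclusion is enough, because \<open>p\<close> is upward closed.\<close>
    then have "?T A \<inter> ?T B \<subseteq> ?T (A \<inter> B)"
      using ultrafilter_Int[OF q] by auto
    then show ?thesis
      using that ultrafilter_Int[OF p] ultrafilter_mono[OF p] unfolding mem by blast
  qed
  moreover have "B \<in> beta_mult p q" if "A \<in> beta_mult p q" "A \<subseteq> B" for A B
  proof -
    have "left_translate_inv x A \<subseteq> left_translate_inv x B" for x
      using that(2) by (auto simp: left_translate_inv_def)
    then have "?T A \<subseteq> ?T B"
      using ultrafilter_mono[OF q] by blast
    then show ?thesis
      using that(1) ultrafilter_mono[OF p] unfolding mem by blast
  qed
  moreover have "A \<in> beta_mult p q \<or> - A \<in> beta_mult p q" for A
  proof -
    have "left_translate_inv x (- A) = - left_translate_inv x A" for x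
      by (auto simp: left_translate_inv_def)
    \<comment> \<open>Equality rests on \<open>q\<close> being an ultrafilter: it contains the
      complement of a set exactly when it omits the set.\<close>
    then have "?T (- A) = - ?T A"
      using ultrafilter_Compl_iff[OF q] by auto
    then show ?thesis
      using ultrafilter_Compl_iff[OF p, of "?T A"] unfolding mem by auto
  qed
  ultimately show ?thesis
    by (simp add: is_ultrafilter_def)
qed

text \<open>Isolates the bookkeeping shared by both sides of the ideal property. Since
  \<open>t\<close> is kept and only the outer factors change, the bound \<open>r\<close> for
  \<open>B\<close> also serves \<open>A\<close>. The new factors may depend on \<open>F\<close> and
  \<open>t\<close>, but must be common to all \<open>f\<close> in \<open>F\<close>.\<close>

lemma k_SCR_set_transfer:
  fixes A B :: "'a::semigroup_mult set"
  assumes "k_SCR_set k B"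
    and "\<And>(F :: (nat \<Rightarrow> 'a) set) t a1 a2. finite F \<Longrightarrow> \<forall>f\<in>F. a1 * f t * a2 \<in> B
      \<Longrightarrow> \<exists>b1 b2. \<forall>f\<in>F. b1 * f t * b2 \<in> A"
  shows "k_SCR_set k A"
proof -
  obtain r :: nat where r: "r \<in> {1..}"
    and B: "\<And>F. F \<subseteq> ({1..} \<rightarrow>\<^sub>E UNIV) \<and> finite F \<and> F \<noteq> {} \<and> card F \<le> k \<Longrightarrow>
      \<exists>a1 a2. \<exists>t\<in>{1..}. t \<le> r \<and> (\<forall>f\<in>F. a1 * f t * a2 \<in> B)"
    using assms(1) unfolding k_SCR_set_def by (elim bexE) simp
  show ?thesis
    unfolding k_SCR_set_def
  proof (intro bexI[OF _ r] allI impI)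
    fix F :: "(nat \<Rightarrow> 'a) set"
    assume F: "F \<subseteq> ({1..} \<rightarrow>\<^sub>E UNIV) \<and> finite F \<and> F \<noteq> {} \<and> card F \<le> k"
    obtain a1 a2 t where t: "t \<in> {1..}" "t \<le> r" and "\<forall>f\<in>F. a1 * f t * a2 \<in> B"
      using B[OF F] by (elim exE bexE conjE)
    then have "\<exists>b1 b2. \<forall>f\<in>F. b1 * f t * b2 \<in> A"
      using assms(2) F by simp
    then obtain b1 b2 where "\<forall>f\<in>F. b1 * f t * b2 \<in> A"
      by (elim exE)
    then show "\<exists>a1 a2. \<exists>t\<in>{1..}. t \<le> r \<and> (\<forall>f\<in>F. a1 * f t * a2 \<in> A)"
      using t by (intro exI[of _ b1] exI[of _ b2] bexI[of _ t] conjI)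
  qed
qed

text \<open>Used when the arbitrary ultrafilter is the left factor of the product.\<close>

lemma k_SCR_set_left_translate:
  assumes "k_SCR_set k (left_translate_inv s A)"
  shows "k_SCR_set k A"
proof (rule k_SCR_set_transfer[OF assms])
  fix F :: "(nat \<Rightarrow> 'a) set" and t a1 a2
  assume "\<forall>f\<in>F. a1 * f t * a2 \<in> left_translate_inv s A"
  then have "\<forall>f\<in>F. (s * a1) * f t * a2 \<in> A"
    by (simp add: left_translate_inv_def mult.assoc)
  then show "\<exists>b1 b2. \<forall>f\<in>F. b1 * f t * b2 \<in> A"
    by (intro exI)
qed

text \<open>Used when the arbitrary ultrafilter, here \<open>q\<close>, is the right factor of the
  product.\<close>

lemma k_SCR_set_of_translates:
  assumes q: "is_ultrafilter q"
    and scr: "k_SCR_set k {x. left_translate_inv x A \<in> q}"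
  shows "k_SCR_set k A"
proof (rule k_SCR_set_transfer[OF scr])
  fix F :: "(nat \<Rightarrow> 'a) set" and t a1 a2
  assume fin: "finite F" and F: "\<forall>f\<in>F. a1 * f t * a2 \<in> {x. left_translate_inv x A \<in> q}"
  \<comment> \<open>Intersecting over the finite set \<open>F\<close> before choosing a point makes
    \<open>b\<close> independent of \<open>f\<close>.\<close>
  have "(\<Inter>f\<in>F. left_translate_inv (a1 * f t * a2) A) \<in> q"
    using F by (intro ultrafilter_finite_INT[OF q fin]) simp
  then obtain b where "\<forall>f\<in>F. b \<in> left_translate_inv (a1 * f t * a2) A"
    using ultrafilter_nonempty[OF q] by blast
  then have "\<forall>f\<in>F. a1 * f t * (a2 * b) \<in> A"
    by (simp add: left_translate_inv_def mult.assoc)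
  then show "\<exists>b1 b2. \<forall>f\<in>F. b1 * f t * b2 \<in> A"
    by (intro exI)
qed

theorem theorem2p6:
  fixes k :: nat
  assumes "k \<ge> 1"
  shows "two_sided_ideal (beta :: 'a::semigroup_mult set set set) beta_mult (k_SCR k)"
proof -
  have "beta_mult p q \<in> k_SCR k" if "p \<in> beta" "q \<in> k_SCR k" for p q :: "'a set set"
  proof -
    have p: "is_ultrafilter p" and q: "is_ultrafilter q" and scr: "\<forall>A\<in>q. k_SCR_set k A"
      using that by (auto simp: beta_def k_SCR_def)
    have "k_SCR_set k A" if "A \<in> beta_mult p q" for A
    proof -
      \<comment> \<open>The set of such \<open>s\<close> belongs to \<open>p\<close>, hence is
        nonempty.\<close>
      obtain s where "left_translate_inv s A \<in> q"
        using \<open>A \<in> beta_mult p q\<close> ultrafilter_nonempty[OF p] unfolding beta_mult_def by blast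
      then show ?thesis using scr k_SCR_set_left_translate by blast
    qed
    then show ?thesis
      using beta_mult_is_ultrafilter[OF p q] by (simp add: k_SCR_def beta_def)
  qed
  moreover have "beta_mult q p \<in> k_SCR k" if "p \<in> beta" "q \<in> k_SCR k" for p q :: "'a set set"
  proof -
    have p: "is_ultrafilter p" and q: "is_ultrafilter q" and scr: "\<forall>A\<in>q. k_SCR_set k A"
      using that by (auto simp: beta_def k_SCR_def)
    \<comment> \<open>Here the set of all \<open>x\<close> with
      \<open>left_translate_inv x A \<in> p\<close> is itself a member of \<open>q\<close>, hence
      rich.\<close>
    have "k_SCR_set k A" if "A \<in> beta_mult q p" for A
      using that scr k_SCR_set_of_translates[OF p] by (simp add: beta_mult_def)
    then show ?thesis
      using beta_mult_is_ultrafilter[OF q p] by (simp add: k_SCR_def beta_def)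
  qed
  moreover have "k_SCR k \<subseteq> (beta :: 'a set set set)"
    by (auto simp: k_SCR_def)
  ultimately show ?thesis
    by (simp add: two_sided_ideal_def)
qed

end
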